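(* Let $d\ge1$ and let $\mathbf{r}=(r_1,\ldots,r_d)\colon\mathbb{N}\to(0,\frac12)^d$. Let $\mathcal{A}=(A_n)_{n\in\mathbb{N}}$ be a sequence of integral $d\times d$ matrices. Assume that $\det(A_m-A_n)\ne0$ for all $m,n\in\mathbb{N}$ with $m\ne n$. Then, for $\mathcal{L}^d$-almost all $\boldsymbol\alpha\in[0,1)^d$, $$\mathcal{L}^d\big(\mathcal{T}_{\boldsymbol\alpha}(\mathcal{A},\mathbf{r})\big)=\begin{cases}0,&\text{if }\sum_{n=1}^\infty\prod_{i=1}^d r_i(n)<\infty,\\ 1,&\text{if }\sum_{n=1}^\infty\prod_{i=1}^d r_i(n)=\infty.\end{cases}$$
   Context: $\mathbb{N}=\{1,2,\ldots\}$. $\mathcal{L}^d$ is $d$-dimensional Lebesgue measure. $\|x\|$ denotes the distance from a real number $x$ to the nearest integer. $\mathcal{R}_n(\mathbf{r})=\{\mathbf{x}\in[0,1)^d:\|x_i\|\le r_i(n),\ 1\le i\le d\}$, and $$\mathcal{T}_{\boldsymbol\alpha}(\mathcal{A},\mathbf{r})=\{\boldsymbol\beta\in[0,1)^d: A_n\boldsymbol\alpha\in\boldsymbol\beta+\mathcal{R}_n(\mathbf{r})\ (\mathrm{mod}\ 1)\text{ for infinitely many } n\in\mathbb{N}\},$$ i.e. $\boldsymbol\beta$ belongs to this set iff for infinitely many $n$ one has $\|(A_n\boldsymbol\alpha)_i-\beta_i\|\le r_i(n)$ for all $1\le i\le d$. No monotonicity of the $r_i$ is assumed. *)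

theory Defs
  imports "HOL-Analysis.Analysis"
begin

definition int_dist :: "real \<Rightarrow> real" where
  "int_dist x = \<bar>x - of_int (round x)\<bar>"

definition unit_cube :: "(real ^ 'd) set" where
  "unit_cube = {x. \<forall>i. 0 \<le> x $ i \<and> x $ i < 1}"

definition cong_mod_1 :: "real ^ 'd \<Rightarrow> real ^ 'd \<Rightarrow> bool" where
  "cong_mod_1 x y \<longleftrightarrow> (\<forall>i. x $ i - y $ i \<in> \<int>)"

definition target_rect :: "(nat \<Rightarrow> real ^ 'd) \<Rightarrow> nat \<Rightarrow> (real ^ 'd) set" where
  "target_rect r n = {x \<in> unit_cube. \<forall>i. int_dist (x $ i) \<le> r n $ i}"

text \<open>
  Indices range over the positive integers: the values of \<open>A\<close> and \<open>r\<close> at \<open>0\<close> play no role.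
\<close>

definition target_set ::
  "real ^ 'd \<Rightarrow> (nat \<Rightarrow> int ^ 'd ^ 'd) \<Rightarrow> (nat \<Rightarrow> real ^ 'd) \<Rightarrow> (real ^ 'd) set" where
  "target_set \<alpha> A r = {\<beta> \<in> unit_cube.
     infinite {n. 1 \<le> n \<and>
       (\<exists>y \<in> target_rect r n. cong_mod_1 (map_matrix of_int (A n) *v \<alpha>) (\<beta> + y))}}"

lemma int_dist_add_Ints:
  assumes "k \<in> \<int>"
  shows "int_dist (x + k) = int_dist x"
proof -
  obtain m where m: "k = of_int m" using assms by (auto elim: Ints_cases)
  have "round (x + of_int m) = \<lfloor>(x + 1/2) + of_int m\<rfloor>"
    by (simp add: round_def algebra_simps)
  then have "round (x + of_int m) = round x + m"
    by (simp only: floor_add_int[symmetric] round_def)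
  then show ?thesis by (simp add: int_dist_def m)
qed

text \<open>\<open>int_dist\<close> is the distance to the set of integers.\<close>

lemma int_dist_eq_infdist: "int_dist x = infdist x \<int>"
proof (rule antisym)
  show "int_dist x \<le> infdist x \<int>"
    unfolding infdist_def
    by (auto simp: int_dist_def dist_real_def abs_minus_commute
        intro!: cINF_greatest round_diff_minimal elim!: Ints_cases)
  show "infdist x \<int> \<le> int_dist x"
    using infdist_le[of "of_int (round x)" "\<int>" x] by (simp add: int_dist_def dist_real_def)
qed

lemma target_rect_cong_iff:
  "(\<exists>y \<in> target_rect r n. cong_mod_1 x (\<beta> + y)) \<longleftrightarrow>
     (\<forall>i. int_dist (x $ i - \<beta> $ i) \<le> r n $ i)"
proof
  assume "\<exists>y \<in> target_rect r n. cong_mod_1 x (\<beta> + y)"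
  then obtain y where y: "y \<in> target_rect r n" "cong_mod_1 x (\<beta> + y)" by blast
  show "\<forall>i. int_dist (x $ i - \<beta> $ i) \<le> r n $ i"
  proof
    fix i
    have "x $ i - (\<beta> $ i + y $ i) \<in> \<int>" using y(2) by (simp add: cong_mod_1_def)
    from int_dist_add_Ints[OF this, of "y $ i"]
    have "int_dist (x $ i - \<beta> $ i) = int_dist (y $ i)" by (simp add: algebra_simps)
    then show "int_dist (x $ i - \<beta> $ i) \<le> r n $ i"
      using y(1) by (simp add: target_rect_def)
  qed
next
  assume *: "\<forall>i. int_dist (x $ i - \<beta> $ i) \<le> r n $ i"
  define y where "y = (\<chi> i. frac (x $ i - \<beta> $ i))"
  have "int_dist (y $ i) = int_dist (x $ i - \<beta> $ i)" for i
    using int_dist_add_Ints[of "- of_int \<lfloor>x $ i - \<beta> $ i\<rfloor>" "x $ i - \<beta> $ i"]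
    by (simp add: y_def frac_def)
  then have "y \<in> target_rect r n"
    using * by (simp add: target_rect_def unit_cube_def) (simp add: y_def frac_lt_1)
  moreover have "cong_mod_1 x (\<beta> + y)"
    by (simp add: cong_mod_1_def y_def frac_def)
  ultimately show "\<exists>y \<in> target_rect r n. cong_mod_1 x (\<beta> + y)" by blast
qed

lemma mem_target_set_iff:
  "\<beta> \<in> target_set \<alpha> A r \<longleftrightarrow> \<beta> \<in> unit_cube \<and>
     infinite {n. 1 \<le> n \<and>
       (\<forall>i. int_dist ((map_matrix of_int (A n) *v \<alpha>) $ i - \<beta> $ i) \<le> r n $ i)}"
  by (simp only: target_set_def target_rect_cong_iff mem_Collect_eq)

text \<open>Hence \<open>emeasure\<close> does not fall back to its default value \<open>0\<close> on these sets.\<close>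

lemma unit_cube_borel: "(unit_cube :: (real ^ 'd) set) \<in> sets borel"
proof -
  have "{x :: real ^ 'd. 0 \<le> x $ i} \<inter> {x. x $ i < 1} \<in> sets borel" for i
    by (intro sets.Int borel_closed borel_open closed_Collect_le open_Collect_less
        continuous_intros)
  then have "(\<Inter>i. {x :: real ^ 'd. 0 \<le> x $ i} \<inter> {x. x $ i < 1}) \<in> sets borel"
    by (intro sets.countable_INT'') auto
  also have "(\<Inter>i. {x :: real ^ 'd. 0 \<le> x $ i} \<inter> {x. x $ i < 1}) = unit_cube"
    by (auto simp: unit_cube_def)
  finally show ?thesis .
qed

lemma target_set_borel: "target_set \<alpha> A r \<in> sets borel"
proof -
  let ?S = "\<lambda>n. {\<beta>. 1 \<le> n \<and>
    (\<forall>i. int_dist ((map_matrix of_int (A n) *v \<alpha>) $ i - \<beta> $ i) \<le> r n $ i)}"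
  have "closed (?S n)" for n
    unfolding int_dist_eq_infdist
    by (intro closed_Collect_conj closed_Collect_const closed_Collect_all closed_Collect_le
        continuous_intros)
  then have "unit_cube \<inter> (\<Inter>m. \<Union>n\<in>{m..}. ?S n) \<in> sets borel"
    by (intro sets.Int unit_cube_borel sets.countable_INT'' sets.countable_UN'' borel_closed) auto
  also have "unit_cube \<inter> (\<Inter>m. \<Union>n\<in>{m..}. ?S n) = target_set \<alpha> A r"
    by (rule set_eqI)
      (simp add: mem_target_set_iff infinite_nat_iff_unbounded_le Bex_def)
  finally show ?thesis .
qed

end

theory Submission
  imports Defs "HOL-Probability.Probability_Measure"
begin

text \<open>
  The idea is to randomise \<open>\<alpha>\<close> and \<open>\<beta>\<close> simultaneously. On the product of two tori, let \<open>E\<^sub>n\<close> be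
  the event that \<open>\<beta> - A\<^sub>n \<alpha>\<close> lies, modulo \<open>1\<close>, in the box with half-sides \<open>r\<^sub>i(n)\<close>. For each fixed
  \<open>\<alpha>\<close> the section of \<open>E\<^sub>n\<close> is a translate of that box, of measure \<open>2\<^sup>d \<Prod>\<^sub>i r\<^sub>i(n)\<close>. If the
  products \<open>\<Prod>\<^sub>i r\<^sub>i(n)\<close> are summable, the first Borel--Cantelli lemma, applied in \<open>\<beta>\<close> alone, gives
  measure \<open>0\<close> for every \<open>\<alpha>\<close>.

  In the divergent case the point is that the \<open>E\<^sub>n\<close> are pairwise independent
  (\<open>nn_integral_torus_independent\<close>). Translating \<open>\<beta>\<close> by \<open>A\<^sub>m \<alpha>\<close> turns the pair
  \<open>(\<beta> - A\<^sub>m \<alpha>, \<beta> - A\<^sub>n \<alpha>)\<close> into \<open>(\<beta>, \<beta> + (A\<^sub>m - A\<^sub>n) \<alpha>)\<close>, and since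
  \<open>det (A\<^sub>m - A\<^sub>n) \<noteq> 0\<close> the point \<open>(A\<^sub>m - A\<^sub>n) \<alpha>\<close> is uniformly distributed on the torus and
  independent of \<open>\<beta>\<close>. Chebyshev's inequality uses nothing beyond pairwise independence, so almost
  every pair \<open>(\<alpha>, \<beta>)\<close> lies in infinitely many \<open>E\<^sub>n\<close> (\<open>borel_cantelli_pairwise_indep\<close>); Fubini's
  theorem turns this into the assertion for almost every \<open>\<alpha>\<close>.

  That a nonsingular integer matrix preserves the measure of the torus
  (\<open>nn_integral_torus_real_matrix\<close>) follows from translation invariance, as in the proof that Haar
  measure is unique: no change of variables and no count of preimages enters.
\<close>

section \<open>The divergence half of Borel--Cantelli under pairwise independence\<close>

text \<open>
  Chebyshev's inequality for the number of the events that occur. Its mean is \<open>m = \<Sum> prob (E n)\<close>;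
  pairwise independence removes the covariances, so its variance is at most \<open>m\<close>, and the number
  can only vanish by deviating from the mean by \<open>m\<close>, which has probability at most \<open>m / m\<^sup>2\<close>.
  Multiplying out covers \<open>m = 0\<close> as well.
\<close>

lemma (in prob_space) pairwise_indep_prob_none_le:
  assumes F: "finite F" and E [measurable]: "\<And>n. n \<in> F \<Longrightarrow> E n \<in> events"
    and indep: "\<And>m n. m \<in> F \<Longrightarrow> n \<in> F \<Longrightarrow> m \<noteq> n \<Longrightarrow> prob (E m \<inter> E n) = prob (E m) * prob (E n)"
  shows "(\<Sum>n\<in>F. prob (E n)) * prob {x \<in> space M. \<forall>n\<in>F. x \<notin> E n} \<le> 1"
proof -
  define p where "p n = prob (E n)" for n
  define m where "m = (\<Sum>n\<in>F. p n)"
  define D where "D n x = indicator (E n) x - p n" for n x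
  let ?Z = "{x \<in> space M. \<forall>n\<in>F. x \<notin> E n}"
  have Z: "?Z \<in> events"
    using F by measurable
  have m0: "m \<ge> 0" unfolding m_def p_def by (intro sum_nonneg) auto
  have DD: "D i x * D j x = indicator (E i \<inter> E j) x - p j * indicator (E i) x - p i * indicator (E j) x + p i * p j"
    for i j x
    unfolding D_def by (simp add: indicator_inter_arith algebra_simps)
  have ind: "integrable M (\<lambda>x. indicator (E i) x :: real)" "integrable M (\<lambda>x. indicator (E i \<inter> E j) x :: real)"
    "expectation (\<lambda>x. indicator (E i) x) = p i" "expectation (\<lambda>x. indicator (E i \<inter> E j) x) = prob (E i \<inter> E j)"
    if "i \<in> F" "j \<in> F" for i j
    using that E[of i] E[of j] by (auto simp: p_def emeasure_eq_measure intro!: integrable_real_indicator)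
  have int: "integrable M (\<lambda>x. D i x * D j x)" if "i \<in> F" "j \<in> F" for i j
    unfolding DD using ind that by (intro Bochner_Integration.integrable_add Bochner_Integration.integrable_diff integrable_mult_right) auto
  have cov: "expectation (\<lambda>x. D i x * D j x) = prob (E i \<inter> E j) - p i * p j" if "i \<in> F" "j \<in> F" for i j
    unfolding DD using ind that by (simp add: prob_space)
  \<comment> \<open>On the diagonal the variance \<open>p i - (p i)\<^sup>2\<close> is at most \<open>p i\<close>.\<close>
  have covle: "expectation (\<lambda>x. D i x * D j x) \<le> (if i = j then p i else 0)" if "i \<in> F" "j \<in> F" for i j
    using cov[OF that] indep[OF that] by (auto simp: p_def)
  have "m\<^sup>2 * prob ?Z = expectation (\<lambda>x. m\<^sup>2 * indicator ?Z x)"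
    using Z by simp
  also have "\<dots> \<le> expectation (\<lambda>x. \<Sum>i\<in>F. \<Sum>j\<in>F. D i x * D j x)"
  proof (rule integral_mono)
    show "integrable M (\<lambda>x. m\<^sup>2 * indicator ?Z x)"
      using Z by (intro integrable_mult_right integrable_real_indicator) (auto simp: emeasure_eq_measure)
    show "integrable M (\<lambda>x. \<Sum>i\<in>F. \<Sum>j\<in>F. D i x * D j x)"
      using int by (intro Bochner_Integration.integrable_sum) auto
    fix x
    have sq: "(\<Sum>i\<in>F. \<Sum>j\<in>F. D i x * D j x) = (\<Sum>i\<in>F. D i x)\<^sup>2"
      by (simp add: power2_eq_square sum_product)
    show "m\<^sup>2 * indicator ?Z x \<le> (\<Sum>i\<in>F. \<Sum>j\<in>F. D i x * D j x)"
    proof (cases "x \<in> ?Z")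
      case True
      then have "(\<Sum>i\<in>F. D i x) = - m"
        unfolding m_def sum_negf[symmetric] by (intro sum.cong) (auto simp: D_def)
      then show ?thesis using sq by (simp add: indicator_def)
    qed (simp add: sq)
  qed
  also have "\<dots> = (\<Sum>i\<in>F. \<Sum>j\<in>F. expectation (\<lambda>x. D i x * D j x))"
    using int by (subst Bochner_Integration.integral_sum; simp)+
  also have "\<dots> \<le> (\<Sum>i\<in>F. \<Sum>j\<in>F. if i = j then p i else 0)"
    by (intro sum_mono covle)
  also have "\<dots> = m"
    using F by (simp add: m_def)
  finally have "m * (m * prob ?Z) \<le> m * 1"
    by (simp add: power2_eq_square)
  then show ?thesis
    using m0 by (cases "m = 0") (auto simp: m_def p_def)
qed

text \<open>
  By divergence, the expected number of events among \<open>E N, \<dots>, E (N + k - 1)\<close> is unbounded in \<open>k\<close>, so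
  the Chebyshev bound forces the event that nothing occurs from \<open>N\<close> on to be null, for each \<open>N\<close>.
\<close>

lemma (in prob_space) borel_cantelli_pairwise_indep:
  fixes E :: "nat \<Rightarrow> 'a set"
  assumes E [measurable]: "\<And>n. E n \<in> events"
    and indep: "\<And>m n. m \<noteq> n \<Longrightarrow> prob (E m \<inter> E n) = prob (E m) * prob (E n)"
    and div: "\<not> summable (\<lambda>n. prob (E n))"
  shows "AE x in M. \<exists>\<^sub>\<infinity>n. x \<in> E n"
proof -
  have "AE x in M. \<exists>n\<ge>N. x \<in> E n" for N
  proof -
    let ?Z = "{x \<in> space M. \<forall>n\<ge>N. x \<notin> E n}"
    have le: "(\<Sum>n<k. prob (E (n + N))) * prob ?Z \<le> 1" for k
    proof -
      have "(\<Sum>n<k. prob (E (n + N))) = (\<Sum>n\<in>{N..<k + N}. prob (E n))"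
        using sum.shift_bounds_nat_ivl[of "\<lambda>n. prob (E n)" 0 N k] by (simp add: atLeast0LessThan)
      moreover have "prob ?Z \<le> prob {x \<in> space M. \<forall>n\<in>{N..<k + N}. x \<notin> E n}"
        by (intro finite_measure_mono) auto
      ultimately have "(\<Sum>n<k. prob (E (n + N))) * prob ?Z
          \<le> (\<Sum>n\<in>{N..<k + N}. prob (E n)) * prob {x \<in> space M. \<forall>n\<in>{N..<k + N}. x \<notin> E n}"
        by (auto intro!: mult_left_mono sum_nonneg)
      also have "\<dots> \<le> 1"
        by (intro pairwise_indep_prob_none_le indep) auto
      finally show ?thesis .
    qed
    have "prob ?Z = 0"
    proof (rule ccontr)
      assume "prob ?Z \<noteq> 0"
      then have pos: "prob ?Z > 0" by (simp add: zero_less_measure_iff)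
      then have "(\<Sum>n<k. prob (E (n + N))) \<le> 1 / prob ?Z" for k
        using le[of k] by (simp add: field_simps)
      then have "summable (\<lambda>n. prob (E (n + N)))"
        by (intro summableI_nonneg_bounded) auto
      then show False using div summable_iff_shift[of "\<lambda>n. prob (E n)" N] by simp
    qed
    then have "AE x in M. x \<notin> ?Z"
      by (intro AE_not_in) (auto simp: null_sets_def emeasure_eq_measure)
    with AE_space show ?thesis by eventually_elim auto
  qed
  then have "AE x in M. \<forall>N. \<exists>n\<ge>N. x \<in> E n"
    by (simp add: AE_all_countable)
  then show ?thesis
    by (simp add: INFM_nat_le)
qed

section \<open>Integration over the torus\<close>

text \<open>
  The torus is represented by its fundamental domain \<open>unit_cube\<close>, and functions on it by
  \<open>\<int>\<^sup>d\<close>-periodic functions on the whole space. A density, rather than a restricted space, keeps every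
  Borel function on \<open>\<real>\<^sup>d\<close> measurable without side conditions.
\<close>

definition torus_measure :: "(real ^ 'd) measure" where
  "torus_measure = density lborel (indicator unit_cube)"

definition lattice_vec :: "('d::finite \<Rightarrow> int) \<Rightarrow> real ^ 'd" where
  "lattice_vec k = (\<chi> i. of_int (k i))"

definition lattice_periodic :: "(real ^ 'd \<Rightarrow> 'a) \<Rightarrow> bool" where
  "lattice_periodic f \<longleftrightarrow> (\<forall>x k. f (x + lattice_vec k) = f x)"

lemma lattice_periodicD: "lattice_periodic f \<Longrightarrow> f (x + lattice_vec k) = f x"
  by (simp add: lattice_periodic_def)

lemma lattice_periodic_translate: "lattice_periodic f \<Longrightarrow> lattice_periodic (\<lambda>x. f (x + c))"
  unfolding lattice_periodic_def by (metis add.assoc add.commute)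

declare unit_cube_borel [measurable]

lemma sets_torus_measure [simp, measurable_cong]: "sets torus_measure = sets borel"
  by (simp add: torus_measure_def)

lemma space_torus_measure [simp]: "space torus_measure = UNIV"
  by (simp add: torus_measure_def)

lemma nn_integral_torus_measure:
  "f \<in> borel_measurable borel \<Longrightarrow>
    (\<integral>\<^sup>+x. f x \<partial>torus_measure) = (\<integral>\<^sup>+x. indicator unit_cube x * f x \<partial>lborel)"
  unfolding torus_measure_def by (subst nn_integral_density) auto

lemma AE_torus_measure_iff:
  "(AE x in torus_measure. P x) \<longleftrightarrow> (AE x in lborel. x \<in> unit_cube \<longrightarrow> P x)"
  unfolding torus_measure_def by (subst AE_density) (auto simp: indicator_def)

lemma emeasure_torus_measure:
  "S \<in> sets borel \<Longrightarrow> emeasure torus_measure S = emeasure lborel (unit_cube \<inter> S)"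
  unfolding torus_measure_def
  by (subst emeasure_density) (auto simp: indicator_inter_arith[symmetric])

lemma nn_integral_lborel_translate:
  fixes f :: "'a::euclidean_space \<Rightarrow> ennreal"
  assumes [measurable]: "f \<in> borel_measurable borel"
  shows "(\<integral>\<^sup>+x. f (c + x) \<partial>lborel) = (\<integral>\<^sup>+x. f x \<partial>lborel)"
proof -
  have "(\<integral>\<^sup>+x. f x \<partial>lborel) = (\<integral>\<^sup>+x. f x \<partial>distr lborel borel ((+) c))"
    by (simp only: lborel_distr_plus)
  also have "\<dots> = (\<integral>\<^sup>+x. f (c + x) \<partial>lborel)"
    by (subst nn_integral_distr) auto
  finally show ?thesis by simp
qed

lemma lattice_translate_in_unit_cube_iff:
  "x + lattice_vec k \<in> unit_cube \<longleftrightarrow> k = (\<lambda>i. - \<lfloor>x $ i\<rfloor>)"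
proof -
  have "0 \<le> a + of_int l \<and> a + of_int l < 1 \<longleftrightarrow> l = - \<lfloor>a\<rfloor>" for a :: real and l
    by linarith
  then show ?thesis
    by (auto simp: unit_cube_def lattice_vec_def)
qed

lemma sum_lattice_translates_unit_cube:
  "(\<integral>\<^sup>+k. indicator unit_cube (x + lattice_vec k) \<partial>count_space UNIV) = (1::ennreal)"
proof -
  have "(\<lambda>k. indicator unit_cube (x + lattice_vec k) :: ennreal) = indicator {\<lambda>i. - \<lfloor>x $ i\<rfloor>}"
    by (auto simp: fun_eq_iff indicator_def lattice_translate_in_unit_cube_iff)
  then show ?thesis by (simp add: one_ennreal_def[symmetric])
qed

text \<open>
  Integrating a periodic function over any fundamental domain, or against any weight \<open>g\<close> whose lattice
  translates add up to \<open>1\<close>, gives the same value: insert the partition of unity that comes from the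
  unit cube, and move each translate by its lattice vector, which \<open>f\<close> does not notice. The roles of
  \<open>g\<close> and of the cube are thereby exchanged.
\<close>

lemma nn_integral_periodic_partition_of_unity:
  fixes f g :: "real ^ 'd \<Rightarrow> ennreal"
  assumes [measurable]: "f \<in> borel_measurable borel" "g \<in> borel_measurable borel"
    and f: "lattice_periodic f"
    and g: "\<And>x. (\<integral>\<^sup>+k. g (x + lattice_vec k) \<partial>count_space UNIV) = 1"
  shows "(\<integral>\<^sup>+x. g x * f x \<partial>lborel) = (\<integral>\<^sup>+x. f x \<partial>torus_measure)"
proof -
  let ?Q = "indicator unit_cube :: real ^ 'd \<Rightarrow> ennreal"
  have "(\<integral>\<^sup>+x. g x * f x \<partial>lborel) =
      (\<integral>\<^sup>+x. \<integral>\<^sup>+k. ?Q (x + lattice_vec k) * (g x * f x) \<partial>count_space UNIV \<partial>lborel)"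
    by (simp add: nn_integral_multc sum_lattice_translates_unit_cube)
  also have "\<dots> = (\<integral>\<^sup>+k. \<integral>\<^sup>+x. ?Q (x + lattice_vec k) * (g x * f x) \<partial>lborel \<partial>count_space UNIV)"
    by (intro nn_integral_count_space_nn_integral) auto
  also have "\<dots> = (\<integral>\<^sup>+k. \<integral>\<^sup>+x. ?Q x * (g (x - lattice_vec k) * f x) \<partial>lborel \<partial>count_space UNIV)"
  proof (rule nn_integral_cong)
    fix k :: "'d \<Rightarrow> int"
    have "f (x - lattice_vec k) = f x" for x
      using lattice_periodicD[OF f, of "x - lattice_vec k" k] by simp
    then show "(\<integral>\<^sup>+x. ?Q (x + lattice_vec k) * (g x * f x) \<partial>lborel) =
        (\<integral>\<^sup>+x. ?Q x * (g (x - lattice_vec k) * f x) \<partial>lborel)"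
      using nn_integral_lborel_translate[of "\<lambda>x. ?Q (x + lattice_vec k) * (g x * f x)" "- lattice_vec k"]
      by simp
  qed
  also have "\<dots> = (\<integral>\<^sup>+k. \<integral>\<^sup>+x. ?Q x * (g (x + lattice_vec k) * f x) \<partial>lborel \<partial>count_space UNIV)"
  proof -
    have "bij_betw uminus (UNIV :: ('d \<Rightarrow> int) set) UNIV"
      by (rule bij_betw_byWitness[of _ uminus]) auto
    moreover have "lattice_vec (- k) = - lattice_vec k" for k :: "'d \<Rightarrow> int"
      by (simp add: lattice_vec_def vec_eq_iff)
    ultimately show ?thesis
      using nn_integral_bij_count_space[of uminus "UNIV :: ('d \<Rightarrow> int) set" UNIV
        "\<lambda>k. \<integral>\<^sup>+x. ?Q x * (g (x + lattice_vec k) * f x) \<partial>lborel"] by simp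
  qed
  also have "\<dots> = (\<integral>\<^sup>+x. \<integral>\<^sup>+k. ?Q x * (g (x + lattice_vec k) * f x) \<partial>count_space UNIV \<partial>lborel)"
    by (intro nn_integral_count_space_nn_integral[symmetric]) auto
  also have "\<dots> = (\<integral>\<^sup>+x. ?Q x * f x \<partial>lborel)"
    by (simp add: nn_integral_multc nn_integral_cmult g)
  also have "\<dots> = (\<integral>\<^sup>+x. f x \<partial>torus_measure)"
    by (rule nn_integral_torus_measure[symmetric]) measurable
  finally show ?thesis .
qed

text \<open>
  The translated cube is again a fundamental domain. This form serves twice: for translation invariance,
  and to measure the boxes around lattice points in a cube centred at the origin.
\<close>

lemma nn_integral_torus_translate_domain:
  fixes f :: "real ^ 'd \<Rightarrow> ennreal"
  assumes [measurable]: "f \<in> borel_measurable borel" and f: "lattice_periodic f"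
  shows "(\<integral>\<^sup>+x. indicator unit_cube (x - c) * f x \<partial>lborel) = (\<integral>\<^sup>+x. f x \<partial>torus_measure)"
proof -
  have "x + lattice_vec k - c = (x - c) + lattice_vec k" for x k
    by simp
  then have "(\<integral>\<^sup>+k. indicator unit_cube (x + lattice_vec k - c) \<partial>count_space UNIV) = (1::ennreal)" for x
    by (simp only: sum_lattice_translates_unit_cube)
  then show ?thesis
    by (intro nn_integral_periodic_partition_of_unity f) simp_all
qed

lemma nn_integral_torus_translate:
  fixes f :: "real ^ 'd \<Rightarrow> ennreal"
  assumes [measurable]: "f \<in> borel_measurable borel" and f: "lattice_periodic f"
  shows "(\<integral>\<^sup>+x. f (x + c) \<partial>torus_measure) = (\<integral>\<^sup>+x. f x \<partial>torus_measure)"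
proof -
  have "(\<integral>\<^sup>+x. f (x + c) \<partial>torus_measure) = (\<integral>\<^sup>+x. indicator unit_cube x * f (x + c) \<partial>lborel)"
    by (intro nn_integral_torus_measure) measurable
  also have "\<dots> = (\<integral>\<^sup>+x. indicator unit_cube (x - c) * f x \<partial>lborel)"
    using nn_integral_lborel_translate[of "\<lambda>x. indicator unit_cube (x - c) * f x" c]
    by (simp add: add.commute)
  finally show ?thesis
    by (simp add: nn_integral_torus_translate_domain f)
qed

lemma emeasure_lborel_cbox_cart:
  fixes a b :: "real ^ 'd"
  assumes "\<And>i. a $ i \<le> b $ i"
  shows "emeasure lborel (cbox a b) = ennreal (\<Prod>i\<in>UNIV. b $ i - a $ i)"
proof -
  have "cbox a b \<noteq> {}"
    using assms by (auto simp: interval_ne_empty_cart)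
  then show ?thesis
    unfolding content_cbox_cart[OF \<open>cbox a b \<noteq> {}\<close>, symmetric]
    by (subst emeasure_eq_ennreal_measure) (auto simp: emeasure_lborel_cbox_eq)
qed

lemma emeasure_unit_cube: "emeasure lborel (unit_cube :: (real ^ 'd) set) = 1"
proof -
  have "emeasure lborel (unit_cube :: (real ^ 'd) set) = emeasure lborel (cbox 0 1 :: (real ^ 'd) set)"
  proof (rule antisym)
    show "emeasure lborel (unit_cube :: (real ^ 'd) set) \<le> emeasure lborel (cbox 0 1 :: (real ^ 'd) set)"
      by (intro emeasure_mono) (auto simp: unit_cube_def mem_box_cart less_imp_le)
    have "emeasure lborel (cbox 0 1 :: (real ^ 'd) set) = emeasure lborel (box 0 1 :: (real ^ 'd) set)"
      by (simp add: emeasure_lborel_box_eq emeasure_lborel_cbox_eq)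
    also have "\<dots> \<le> emeasure lborel (unit_cube :: (real ^ 'd) set)"
      by (intro emeasure_mono) (auto simp: unit_cube_def mem_box_cart less_imp_le)
    finally show "emeasure lborel (cbox 0 1 :: (real ^ 'd) set) \<le> emeasure lborel (unit_cube :: (real ^ 'd) set)" .
  qed
  then show ?thesis
    by (simp add: emeasure_lborel_cbox_cart)
qed

interpretation torus: prob_space "torus_measure :: (real ^ 'd) measure"
  by (rule prob_spaceI) (simp add: emeasure_torus_measure emeasure_unit_cube)

interpretation torus2: pair_prob_space "torus_measure :: (real ^ 'd) measure" "torus_measure :: (real ^ 'd) measure"
  ..

section \<open>Integer matrices acting on the torus\<close>

abbreviation real_matrix :: "int ^ 'd ^ 'd \<Rightarrow> real ^ 'd ^ 'd" where
  "real_matrix A \<equiv> map_matrix of_int A"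

lemma det_real_matrix: "det (real_matrix A) = of_int (det A)"
  by (simp add: det_def)

lemma real_matrix_diff: "real_matrix (A - B) = real_matrix A - real_matrix B"
  by (simp add: vec_eq_iff)

lemma real_matrix_mult_lattice_vec:
  "real_matrix A *v lattice_vec k = lattice_vec (\<lambda>i. \<Sum>j\<in>UNIV. A $ i $ j * k j)"
  by (simp add: vec_eq_iff lattice_vec_def matrix_vector_mult_def)

lemma lattice_periodic_real_matrix:
  "lattice_periodic f \<Longrightarrow> lattice_periodic (\<lambda>x. f (real_matrix A *v x))"
  by (simp add: lattice_periodic_def matrix_vector_right_distrib real_matrix_mult_lattice_vec)

lemma borel_measurable_matrix_vector_mult [measurable]:
  fixes M :: "real ^ 'n ^ 'm"
  shows "(\<lambda>x. M *v x) \<in> borel_measurable borel"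
  by (intro borel_measurable_continuous_onI matrix_vector_mult_linear_continuous_on)

text \<open>
  Since \<open>M\<close> is surjective on \<open>\<real>\<^sup>d\<close>, a translation by \<open>c = M y\<close> after applying \<open>M\<close> is a translation by
  \<open>y\<close> before it. So the integral of \<open>f (c + M x)\<close> over \<open>x\<close> is independent of \<open>c\<close> and equals its average over
  \<open>c\<close>; exchanging the integrals and translating in \<open>c\<close> gives the integral of \<open>f\<close>.
\<close>

lemma nn_integral_torus_real_matrix:
  fixes f :: "real ^ 'd \<Rightarrow> ennreal"
  assumes [measurable]: "f \<in> borel_measurable borel" and f: "lattice_periodic f"
    and A: "det A \<noteq> 0"
  shows "(\<integral>\<^sup>+x. f (real_matrix A *v x) \<partial>torus_measure) = (\<integral>\<^sup>+x. f x \<partial>torus_measure)"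
proof -
  let ?M = "real_matrix A"
  have "invertible ?M"
    using A by (simp add: invertible_det_nz det_real_matrix)
  then obtain N where "?M ** N = mat 1"
    by (auto simp: invertible_def)
  then have inv: "?M *v (N *v c) = c" for c
    by (simp add: matrix_vector_mul_assoc)
  have shift: "(\<integral>\<^sup>+x. f (?M *v x) \<partial>torus_measure) = (\<integral>\<^sup>+x. f (c + ?M *v x) \<partial>torus_measure)" for c
    using nn_integral_torus_translate[of "\<lambda>x. f (?M *v x)" "N *v c"]
    by (simp add: lattice_periodic_real_matrix f matrix_vector_right_distrib inv add.commute)
  have "(\<integral>\<^sup>+x. f (?M *v x) \<partial>torus_measure) =
      (\<integral>\<^sup>+c. \<integral>\<^sup>+x. f (c + ?M *v x) \<partial>torus_measure \<partial>torus_measure)"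
    by (simp add: shift[symmetric] torus.emeasure_space_1[simplified])
  also have "\<dots> = (\<integral>\<^sup>+x. \<integral>\<^sup>+c. f (c + ?M *v x) \<partial>torus_measure \<partial>torus_measure)"
    by (rule torus2.Fubini') measurable
  also have "\<dots> = (\<integral>\<^sup>+x. f x \<partial>torus_measure)"
    by (simp add: nn_integral_torus_translate f torus.emeasure_space_1[simplified])
  finally show ?thesis .
qed

text \<open>
  After the translation of \<open>\<beta>\<close> by \<open>A \<alpha>\<close>, the factor \<open>f \<beta>\<close> is free of \<open>\<alpha>\<close>, and the inner integral of
  \<open>g ((A - B) \<alpha> + \<beta>)\<close> over \<open>\<alpha>\<close> no longer depends on \<open>\<beta>\<close>.
\<close>

lemma nn_integral_torus_independent:
  fixes f g :: "real ^ 'd \<Rightarrow> ennreal"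
  assumes [measurable]: "f \<in> borel_measurable borel" "g \<in> borel_measurable borel"
    and f: "lattice_periodic f" and g: "lattice_periodic g"
    and det: "det (A - B) \<noteq> 0"
  shows "(\<integral>\<^sup>+\<alpha>. \<integral>\<^sup>+\<beta>. f (\<beta> - real_matrix A *v \<alpha>) * g (\<beta> - real_matrix B *v \<alpha>) \<partial>torus_measure \<partial>torus_measure) =
    (\<integral>\<^sup>+x. f x \<partial>torus_measure) * (\<integral>\<^sup>+x. g x \<partial>torus_measure)"
proof -
  define D where "D = real_matrix (A - B)"
  have "(\<integral>\<^sup>+\<beta>. f (\<beta> - real_matrix A *v \<alpha>) * g (\<beta> - real_matrix B *v \<alpha>) \<partial>torus_measure) =
      (\<integral>\<^sup>+\<beta>. f \<beta> * g (D *v \<alpha> + \<beta>) \<partial>torus_measure)" for \<alpha>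
  proof -
    have "lattice_periodic (\<lambda>\<beta>. f \<beta> * g (D *v \<alpha> + \<beta>))"
      using f lattice_periodic_translate[OF g, of "D *v \<alpha>"]
      by (simp add: lattice_periodic_def add.commute)
    moreover have "D *v \<alpha> + (\<beta> + - (real_matrix A *v \<alpha>)) = \<beta> + - (real_matrix B *v \<alpha>)" for \<beta>
      by (simp add: D_def real_matrix_diff matrix_vector_mult_diff_rdistrib)
    ultimately show ?thesis
      using nn_integral_torus_translate[of "\<lambda>\<beta>. f \<beta> * g (D *v \<alpha> + \<beta>)" "- (real_matrix A *v \<alpha>)"]
      by (simp only: diff_conv_add_uminus) measurable
  qed
  then have "(\<integral>\<^sup>+\<alpha>. \<integral>\<^sup>+\<beta>. f (\<beta> - real_matrix A *v \<alpha>) * g (\<beta> - real_matrix B *v \<alpha>) \<partial>torus_measure \<partial>torus_measure) =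
      (\<integral>\<^sup>+\<alpha>. \<integral>\<^sup>+\<beta>. f \<beta> * g (D *v \<alpha> + \<beta>) \<partial>torus_measure \<partial>torus_measure)"
    by simp
  also have "\<dots> = (\<integral>\<^sup>+\<beta>. \<integral>\<^sup>+\<alpha>. f \<beta> * g (D *v \<alpha> + \<beta>) \<partial>torus_measure \<partial>torus_measure)"
    by (rule torus2.Fubini') measurable
  also have "\<dots> = (\<integral>\<^sup>+\<beta>. f \<beta> * (\<integral>\<^sup>+\<alpha>. g (D *v \<alpha> + \<beta>) \<partial>torus_measure) \<partial>torus_measure)"
    by (intro nn_integral_cong nn_integral_cmult) measurable
  also have "\<dots> = (\<integral>\<^sup>+\<beta>. f \<beta> * (\<integral>\<^sup>+x. g x \<partial>torus_measure) \<partial>torus_measure)"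
  proof -
    have "(\<integral>\<^sup>+\<alpha>. g (D *v \<alpha> + \<beta>) \<partial>torus_measure) = (\<integral>\<^sup>+x. g x \<partial>torus_measure)" for \<beta>
      using nn_integral_torus_real_matrix[of "\<lambda>x. g (x + \<beta>)" "A - B"] nn_integral_torus_translate[of g \<beta>] g det
      by (simp add: lattice_periodic_translate D_def)
    then show ?thesis by simp
  qed
  also have "\<dots> = (\<integral>\<^sup>+x. f x \<partial>torus_measure) * (\<integral>\<^sup>+x. g x \<partial>torus_measure)"
    by (intro nn_integral_multc) measurable
  finally show ?thesis .
qed

section \<open>Boxes around the lattice points\<close>

text \<open>
  The periodic counterpart of \<open>target_rect\<close>: the union of the closed boxes with half-sides \<open>\<rho> $ i\<close> around
  all points of \<open>\<int>\<^sup>d\<close>.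
\<close>

definition near_lattice :: "real ^ 'd \<Rightarrow> (real ^ 'd) set" where
  "near_lattice \<rho> = {x. \<forall>i. int_dist (x $ i) \<le> \<rho> $ i}"

lemma near_lattice_borel [measurable]: "near_lattice \<rho> \<in> sets borel"
  unfolding near_lattice_def int_dist_eq_infdist
  by (intro borel_closed closed_Collect_all closed_Collect_le continuous_intros)

lemma lattice_periodic_near_lattice: "lattice_periodic (indicator (near_lattice \<rho>) :: _ \<Rightarrow> ennreal)"
  by (simp add: lattice_periodic_def near_lattice_def lattice_vec_def int_dist_add_Ints indicator_def)

lemma int_dist_minus: "int_dist (- x) = int_dist x"
proof -
  have "int_dist (- y) \<le> int_dist y" for y
    using round_diff_minimal[of "- y" "- round y"] by (simp add: int_dist_def abs_minus_commute)
  from this[of x] this[of "- x"] show ?thesis by simp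
qed

lemma minus_in_near_lattice_iff: "- x \<in> near_lattice \<rho> \<longleftrightarrow> x \<in> near_lattice \<rho>"
  by (simp add: near_lattice_def int_dist_minus)

text \<open>
  In \<open>[0, 1)\<^sup>d\<close> the set falls apart into pieces at the corners; in the fundamental domain
  \<open>[-1/2, 1/2)\<^sup>d\<close> it is the single box \<open>cbox (- \<rho>) \<rho>\<close>, because \<open>\<rho> $ i < 1/2\<close>.
\<close>

lemma emeasure_torus_near_lattice:
  fixes \<rho> :: "real ^ 'd"
  assumes \<rho>: "\<And>i. 0 < \<rho> $ i \<and> \<rho> $ i < 1/2"
  shows "emeasure torus_measure (near_lattice \<rho>) = ennreal (\<Prod>i\<in>UNIV. 2 * \<rho> $ i)"
proof -
  define h :: "real ^ 'd" where "h = (\<chi> i. 1/2)"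
  have round0: "round a = 0" if "- 1/2 \<le> a" "a < 1/2" for a :: real
    using that unfolding round_def by (intro floor_unique) auto
  have eq: "indicator unit_cube (x - (- h)) * indicator (near_lattice \<rho>) x = (indicator (cbox (- \<rho>) \<rho>) x :: ennreal)" for x
  proof -
    have "x - (- h) \<in> unit_cube \<and> x \<in> near_lattice \<rho> \<longleftrightarrow> x \<in> cbox (- \<rho>) \<rho>"
    proof safe
      assume "x - (- h) \<in> unit_cube" "x \<in> near_lattice \<rho>"
      then have 1: "0 \<le> x $ i + 1/2" "x $ i + 1/2 < 1" "int_dist (x $ i) \<le> \<rho> $ i" for i
        by (auto simp: unit_cube_def h_def near_lattice_def)
      have "\<bar>x $ i\<bar> \<le> \<rho> $ i" for i
        using 1[of i] round0[of "x $ i"] by (simp add: int_dist_def)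
      then show "x \<in> cbox (- \<rho>) \<rho>"
        by (auto simp: mem_box_cart abs_le_iff) (smt (verit))
    next
      assume "x \<in> cbox (- \<rho>) \<rho>"
      then have 1: "- \<rho> $ i \<le> x $ i" "x $ i \<le> \<rho> $ i" for i
        by (auto simp: mem_box_cart)
      have 2: "- 1/2 < x $ i" "x $ i < 1/2" for i
        using 1[of i] \<rho>[of i] by auto
      show "x - (- h) \<in> unit_cube"
      proof -
        have "0 \<le> x $ i + 1/2" "x $ i + 1/2 < 1" for i using 2[of i] by auto
        then show ?thesis by (simp add: unit_cube_def h_def)
      qed
      show "x \<in> near_lattice \<rho>"
        unfolding near_lattice_def
      proof safe
        fix i show "int_dist (x $ i) \<le> \<rho> $ i"
          using 1[of i] 2[of i] round0[of "x $ i"] by (simp add: int_dist_def abs_le_iff)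
      qed
    qed
    then show ?thesis by (auto simp: indicator_def)
  qed
  have "emeasure torus_measure (near_lattice \<rho>) = (\<integral>\<^sup>+x. indicator (near_lattice \<rho>) x \<partial>torus_measure)"
    by simp
  also have "\<dots> = (\<integral>\<^sup>+x. indicator (cbox (- \<rho>) \<rho>) x \<partial>lborel)"
    by (subst nn_integral_torus_translate_domain[symmetric, of _ "- h"])
      (simp_all only: eq lattice_periodic_near_lattice borel_measurable_indicator near_lattice_borel)
  also have "\<dots> = ennreal (\<Prod>i\<in>UNIV. 2 * \<rho> $ i)"
    using \<rho> by (simp add: emeasure_lborel_cbox_cart less_imp_le)
  finally show ?thesis .
qed

lemma emeasure_torus_near_lattice_translate:
  "emeasure torus_measure {\<beta>. \<beta> - c \<in> near_lattice \<rho>} = emeasure torus_measure (near_lattice \<rho>)"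
proof -
  have "emeasure torus_measure {\<beta>. \<beta> - c \<in> near_lattice \<rho>} =
      (\<integral>\<^sup>+\<beta>. indicator {\<beta>. \<beta> - c \<in> near_lattice \<rho>} \<beta> \<partial>torus_measure)"
    by (rule nn_integral_indicator[symmetric]) measurable
  also have "\<dots> = (\<integral>\<^sup>+\<beta>. indicator (near_lattice \<rho>) (\<beta> + - c) \<partial>torus_measure)"
    by (simp add: indicator_def)
  also have "\<dots> = emeasure torus_measure (near_lattice \<rho>)"
    by (subst nn_integral_torus_translate) (auto simp: lattice_periodic_near_lattice)
  finally show ?thesis .
qed

section \<open>The zero-one law\<close>

text \<open>
  The sign is reversed from \<open>A\<^sub>n \<alpha> - \<beta>\<close> to \<open>\<beta> - A\<^sub>n \<alpha>\<close>, which the symmetric boxes permit, so that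
  only translations of \<open>\<beta>\<close>, and no reflections, occur in the integrals.
\<close>

lemma mem_target_set_near_lattice_iff:
  "\<beta> \<in> target_set \<alpha> A r \<longleftrightarrow>
    \<beta> \<in> unit_cube \<and> (\<exists>\<^sub>\<infinity>n. \<beta> - real_matrix (A (Suc n)) *v \<alpha> \<in> near_lattice (r (Suc n)))"
proof -
  let ?P = "\<lambda>n. \<beta> - real_matrix (A n) *v \<alpha> \<in> near_lattice (r n)"
  have "(\<forall>i. int_dist ((real_matrix (A n) *v \<alpha>) $ i - \<beta> $ i) \<le> r n $ i) \<longleftrightarrow> ?P n" for n
    using minus_in_near_lattice_iff[of "\<beta> - real_matrix (A n) *v \<alpha>" "r n"]
    by (simp add: near_lattice_def)
  moreover have "{n. 1 \<le> n \<and> ?P n} = Suc ` {n. ?P (Suc n)}"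
    by (auto simp: image_iff) (metis Suc_le_D One_nat_def)
  then have "infinite {n. 1 \<le> n \<and> ?P n} \<longleftrightarrow> (\<exists>\<^sub>\<infinity>n. ?P (Suc n))"
    by (simp add: finite_image_iff INFM_iff_infinite)
  ultimately show ?thesis
    by (simp add: mem_target_set_iff)
qed

lemma emeasure_target_set:
  "emeasure lebesgue (target_set \<alpha> A r) = emeasure torus_measure (target_set \<alpha> A r)"
proof -
  have "unit_cube \<inter> target_set \<alpha> A r = target_set \<alpha> A r"
    by (auto simp: mem_target_set_near_lattice_iff)
  then show ?thesis
    by (simp add: emeasure_torus_measure target_set_borel)
qed

theorem theorem8:
  fixes r :: "nat \<Rightarrow> real ^ 'd" and A :: "nat \<Rightarrow> int ^ 'd ^ 'd"
  assumes "\<And>n i. 1 \<le> n \<Longrightarrow> 0 < r n $ i \<and> r n $ i < 1/2"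
    and "\<And>m n. 1 \<le> m \<Longrightarrow> 1 \<le> n \<Longrightarrow> m \<noteq> n \<Longrightarrow> det (A m - A n) \<noteq> 0"
  shows "AE \<alpha>\<in>unit_cube in lebesgue.
           emeasure lebesgue (target_set \<alpha> A r) =
             (if summable (\<lambda>n. \<Prod>i\<in>UNIV. r (Suc n) $ i) then 0 else 1)"
proof -
  let ?T = "torus_measure :: (real ^ 'd) measure"
  \<comment> \<open>The boxes have sides \<open>2 * r n $ i\<close>, which makes the measures \<open>c\<close> times the terms of the series.\<close>
  define c :: real where "c = 2 ^ CARD('d)"
  have c: "c \<noteq> 0" by (simp add: c_def)
  define v where "v n = (\<Prod>i\<in>UNIV. r (Suc n) $ i)" for n
  have v0: "0 \<le> v n" for n
    unfolding v_def using assms(1)[of "Suc n"] by (intro prod_nonneg) (simp add: less_imp_le)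
  have em: "emeasure ?T (near_lattice (r (Suc n))) = ennreal (c * v n)" for n
    using assms(1)[of "Suc n"]
    by (subst emeasure_torus_near_lattice) (auto simp: prod.distrib c_def v_def)
  show ?thesis
  proof (cases "summable v")
    case True
    have "emeasure ?T (target_set \<alpha> A r) = 0" for \<alpha>
    proof -
      define S where "S n = {\<beta>. \<beta> - real_matrix (A (Suc n)) *v \<alpha> \<in> near_lattice (r (Suc n))}" for n
      have [measurable]: "S n \<in> sets borel" for n
        unfolding S_def by measurable
      have emS: "emeasure ?T (S n) = ennreal (c * v n)" for n
        by (simp add: S_def emeasure_torus_near_lattice_translate em)
      have "AE \<beta> in ?T. eventually (\<lambda>n. \<beta> \<in> space ?T - S n) sequentially"
      proof (rule borel_cantelli_AE1)
        have "measure ?T (S n) = c * v n" for n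
          by (simp add: measure_def emS v0 c_def)
        then show "summable (\<lambda>n. measure ?T (S n))"
          using True by (simp add: summable_mult)
      qed (auto simp: emS)
      then have "AE \<beta> in ?T. \<beta> \<notin> target_set \<alpha> A r"
        by eventually_elim
          (auto simp: mem_target_set_near_lattice_iff S_def frequently_def cofinite_eq_sequentially)
      then show ?thesis
        using target_set_borel by (subst (asm) AE_iff_measurable[OF _ refl]) auto
    qed
    then show ?thesis
      using True by (simp add: emeasure_target_set v_def[symmetric])
  next
    case False
    \<comment> \<open>The first coordinate of the product is \<open>\<alpha>\<close>, so that \<open>torus2.AE_pair\<close> yields the quantifiers in the right order.\<close>
    let ?T2 = "?T \<Otimes>\<^sub>M ?T"
    define E where "E n = {(\<alpha>, \<beta>). \<beta> - real_matrix (A (Suc n)) *v \<alpha> \<in> near_lattice (r (Suc n))}" for n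
    have E [measurable]: "E n \<in> sets ?T2" for n
    proof -
      have "{z \<in> space ?T2. snd z - real_matrix (A (Suc n)) *v fst z \<in> near_lattice (r (Suc n))} \<in> sets ?T2"
        by measurable
      also have "{z \<in> space ?T2. snd z - real_matrix (A (Suc n)) *v fst z \<in> near_lattice (r (Suc n))} = E n"
        by (auto simp: E_def space_pair_measure)
      finally show ?thesis .
    qed
    have emE: "emeasure ?T2 (E n) = ennreal (c * v n)" for n
    proof -
      have "emeasure ?T2 (E n) = (\<integral>\<^sup>+\<alpha>. emeasure ?T (Pair \<alpha> -` E n) \<partial>?T)"
        by (rule torus.emeasure_pair_measure_alt) (rule E)
      also have "\<dots> = (\<integral>\<^sup>+\<alpha>. ennreal (c * v n) \<partial>?T)"
        by (simp add: E_def vimage_def emeasure_torus_near_lattice_translate em)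
      finally show ?thesis
        by (simp add: torus.emeasure_space_1[simplified])
    qed
    have emE2: "emeasure ?T2 (E m \<inter> E n) = ennreal (c * v m) * ennreal (c * v n)" if "m \<noteq> n" for m n
    proof -
      let ?f = "\<lambda>n. indicator (near_lattice (r (Suc n))) :: real ^ 'd \<Rightarrow> ennreal"
      have "emeasure ?T2 (E m \<inter> E n) = (\<integral>\<^sup>+z. indicator (E m \<inter> E n) z \<partial>?T2)"
        by (rule nn_integral_indicator[symmetric]) measurable
      also have "\<dots> = (\<integral>\<^sup>+\<alpha>. \<integral>\<^sup>+\<beta>. indicator (E m \<inter> E n) (\<alpha>, \<beta>) \<partial>?T \<partial>?T)"
        by (rule torus.nn_integral_fst[symmetric]) measurable
      also have "\<dots> = (\<integral>\<^sup>+\<alpha>. \<integral>\<^sup>+\<beta>. ?f m (\<beta> - real_matrix (A (Suc m)) *v \<alpha>) *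
          ?f n (\<beta> - real_matrix (A (Suc n)) *v \<alpha>) \<partial>?T \<partial>?T)"
        by (intro nn_integral_cong) (auto simp: E_def indicator_def)
      also have "\<dots> = (\<integral>\<^sup>+x. ?f m x \<partial>?T) * (\<integral>\<^sup>+x. ?f n x \<partial>?T)"
        using assms(2)[of "Suc m" "Suc n"] that
        by (intro nn_integral_torus_independent) (auto simp: lattice_periodic_near_lattice)
      finally show ?thesis by (simp add: em)
    qed
    have mE: "torus2.P.prob (E n) = c * v n" for n
      by (simp add: measure_def emE v0 c_def)
    have "AE z in ?T2. \<exists>\<^sub>\<infinity>n. z \<in> E n"
    proof (rule torus2.P.borel_cantelli_pairwise_indep)
      show "\<not> summable (\<lambda>n. torus2.P.prob (E n))"
        using False c by (simp add: mE)
      fix m n :: nat assume "m \<noteq> n"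
      then show "torus2.P.prob (E m \<inter> E n) = torus2.P.prob (E m) * torus2.P.prob (E n)"
        unfolding mE by (simp add: measure_def emE2 v0 c_def enn2real_mult)
    qed (rule E)
    then have "AE \<alpha> in ?T. AE \<beta> in ?T. \<exists>\<^sub>\<infinity>n. (\<alpha>, \<beta>) \<in> E n"
      by (rule torus2.AE_pair)
    then have "AE \<alpha> in ?T. emeasure ?T (target_set \<alpha> A r) = 1"
    proof eventually_elim
      case (elim \<alpha>)
      moreover have "AE \<beta> in ?T. \<beta> \<in> unit_cube"
        by (simp add: AE_torus_measure_iff)
      ultimately have "AE \<beta> in ?T. \<beta> \<in> target_set \<alpha> A r"
        by eventually_elim (simp add: mem_target_set_near_lattice_iff E_def)
      then show ?case
        by (intro torus.emeasure_eq_1_AE) (simp_all add: target_set_borel)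
    qed
    then have "AE \<alpha> in lborel. \<alpha> \<in> unit_cube \<longrightarrow> emeasure lebesgue (target_set \<alpha> A r) = 1"
      by (simp add: AE_torus_measure_iff emeasure_target_set)
    then show ?thesis
      using False by (simp add: v_def[symmetric] AE_completion)
  qed
qed

end
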